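(* For every integer $n\geqslant 0$, $$ b(n) = \sum_{k=0}^{\infty} S\big(n/2-k(k+1)/4 \big), $$ where $S(x)=0$ if $x$ is not a positive integer.
   Context: For a nonnegative integer $n$, $b(n)$ is the total number of parts in all the partitions of $n$ into odd parts minus the total number of parts in all the partitions of $n$ into distinct parts (parts counted with multiplicity); thus $b(0)=0$. For a positive integer $n$, $S(n)$ is the total number of parts (counted with multiplicity) in all the partitions of $n$; for example $S(5)=1+2+2+3+3+4+5=20$. For any rational $x$ that is not a positive integer, $S(x)=0$. *)

theory Defs
  imports Complex_Main "HOL-Library.Multiset"
begin

definition partitions :: "nat \<Rightarrow> nat multiset set" where
  "partitions n = {P. 0 \<notin># P \<and> sum_mset P = n}"

definition odd_partitions :: "nat \<Rightarrow> nat multiset set" where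
  "odd_partitions n = {P \<in> partitions n. \<forall>i \<in># P. odd i}"

definition distinct_partitions :: "nat \<Rightarrow> nat multiset set" where
  "distinct_partitions n = {P \<in> partitions n. \<forall>i. count P i \<le> 1}"

text \<open>The sets over which the sums below range are finite, so none of these sums
  is 0 by the convention for infinite index sets.\<close>

lemma finite_partitions: "finite (partitions n)"
proof -
  have size_le: "size P \<le> sum_mset P" if "0 \<notin># P" for P :: "nat multiset"
    using that by (induction P) auto
  have part_le: "i \<le> sum_mset P" if "i \<in># P" for i and P :: "nat multiset"
    using that by (auto dest: multi_member_split)
  have "partitions n \<subseteq> mset ` {xs. set xs \<subseteq> {..n} \<and> length xs \<le> n}"
  proof
    fix P assume P: "P \<in> partitions n"
    obtain xs where xs: "mset xs = P"
      using ex_mset by blast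
    have "length xs \<le> n"
      using P size_le[of P] unfolding partitions_def xs[symmetric] by simp
    moreover have "set xs \<subseteq> {..n}"
      using P part_le[of _ P] unfolding partitions_def xs[symmetric] by auto
    ultimately show "P \<in> mset ` {xs. set xs \<subseteq> {..n} \<and> length xs \<le> n}"
      using xs by blast
  qed
  then show ?thesis
    by (rule finite_subset) (simp add: finite_lists_length_le)
qed

lemma finite_odd_partitions: "finite (odd_partitions n)"
  unfolding odd_partitions_def by (simp add: finite_partitions)

lemma finite_distinct_partitions: "finite (distinct_partitions n)"
  unfolding distinct_partitions_def by (simp add: finite_partitions)

definition b :: "nat \<Rightarrow> int" where
  "b n = (\<Sum>P \<in> odd_partitions n. int (size P)) - (\<Sum>P \<in> distinct_partitions n. int (size P))"

definition S :: "rat \<Rightarrow> int" where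
  "S x = (if x \<in> \<int> \<and> x > 0 then \<Sum>P \<in> partitions (nat \<lfloor>x\<rfloor>). int (size P) else 0)"

end

theory Submission
  imports Defs "HOL-Computational_Algebra.Formal_Power_Series"
begin

text \<open>
  Partitions into odd parts and into distinct parts are equinumerous (Euler); let \<open>C(q)\<close> be
  their common generating function. Their total numbers of parts are generated by
  \<open>C(q)\<close> times the sum of \<open>q^i/(1-q^i)\<close> over odd \<open>i\<close>, respectively of \<open>q^i/(1+q^i)\<close>
  over all \<open>i\<close>. As \<open>q^i/(1+q^i) = q^i/(1-q^i) - 2q^(2i)/(1-q^(2i))\<close>, the difference is
  \<open>C(q)\<close> times the sum of \<open>q^i/(1-q^i)\<close> over even \<open>i\<close>. By Gauss' identity, \<open>C(q)\<close> is the
  series with exponents \<open>k(k+1)/2\<close> times the generating function of partitions into even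
  parts, and the latter turns the sum over even \<open>i\<close> into the series of \<open>S(m) q^(2m)\<close>.
  All identities are between finite products and hold modulo \<open>q^(2M)\<close>.
\<close>

section \<open>Gauss' triangular number identity in finite form\<close>

text \<open>
  Shanks' finite form of Gauss' identity, with \<open>v r\<close> in the role of \<open>1/(1-q^(2r+1))\<close>. Modulo
  \<open>q^(2n+1)\<close> only the term \<open>s = 0\<close> survives on the left. The difference of consecutive
  left-hand sides telescopes through \<open>U\<close>.
\<close>

lemma shanks_triangular_sum:
  fixes q :: "'a::comm_ring_1"
  assumes v: "\<And>r. (1 - q ^ (2*r+1)) * v r = 1"
  shows "(\<Sum>s<n. (\<Prod>r\<in>{s..<n}. (1 - q ^ (2*r+2)) * v r) * q ^ (s*(2*n+1)))
         = (\<Sum>k<2*n. q ^ (k*(k+1) div 2))"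
proof (induction n)
  case 0
  then show ?case by simp
next
  case (Suc n)
  define R where "R m s = (\<Prod>r\<in>{s..<m}. (1 - q ^ (2*r+2)) * v r)" for m s
  \<comment> \<open>The factor \<open>1 - q ^ (2*s)\<close> makes \<open>U 0\<close> vanish, so the
    telescoped sum leaves only \<open>U n\<close>.\<close>
  define U where "U s = (1 - q ^ (2*s)) * R n s * q ^ (s*(2*n+1))" for s
  have R_Suc: "R (Suc n) s = R n s * ((1 - q ^ (2*n+2)) * v n)" if "s \<le> n" for s
    unfolding R_def using that by (simp add: prod.atLeastLessThan_Suc)
  \<comment> \<open>Raising \<open>s\<close> drops the factor with \<open>r = s\<close>; multiplying
    by \<open>1 - q ^ (2*s+1)\<close> cancels its \<open>v s\<close>. This lets
    \<open>U (Suc s)\<close> be written through \<open>R n s\<close>.\<close>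
  have R_step: "(1 - q ^ (2*s+1)) * R n s = (1 - q ^ (2*s+2)) * R n (Suc s)" if "s < n" for s
  proof -
    have "R n s = (1 - q ^ (2*s+2)) * v s * R n (Suc s)"
      unfolding R_def using that by (simp add: prod.atLeast_Suc_lessThan)
    then have "(1 - q ^ (2*s+1)) * R n s
        = ((1 - q ^ (2*s+1)) * v s) * ((1 - q ^ (2*s+2)) * R n (Suc s))"
      by (simp only: mult_ac)
    then show ?thesis
      using v by simp
  qed
  have U_Suc: "U (Suc s) = (1 - q * q^(2*s)) * R n s * (q ^ (s*(2*n+1)) * q ^ (2*n+1))" if "s < n" for s
  proof -
    have "U (Suc s) = ((1 - q ^ (2*s+2)) * R n (Suc s)) * q ^ (Suc s*(2*n+1))"
      by (simp add: U_def)
    also have "\<dots> = ((1 - q ^ (2*s+1)) * R n s) * q ^ (Suc s*(2*n+1))"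
      by (simp only: R_step[OF that])
    also have "q ^ (Suc s*(2*n+1)) = q ^ (s*(2*n+1)) * q ^ (2*n+1)"
      by (simp only: power_add[symmetric]) (simp add: algebra_simps)
    finally show ?thesis
      by simp
  qed
  have step: "R (Suc n) s * q ^ (s*(2*Suc n+1))
      = R n s * q ^ (s*(2*n+1)) + v n * (U (Suc s) - U s)" if "s < n" for s
  proof -
    define Y a c where "Y = q ^ (s*(2*n+1))" and "a = q ^ (2*n+1)" and "c = q ^ (2*s)"
    have 1: "q ^ (s*(2*Suc n+1)) = Y * c"
      unfolding Y_def c_def by (simp only: power_add[symmetric]) (simp add: algebra_simps)
    have 2: "q ^ (2*n+2) = q * a"
      unfolding a_def by simp
    have 3: "(1 - a) * v n = 1"
      unfolding a_def by (rule v)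
    have "R (Suc n) s * q ^ (s*(2*Suc n+1)) = R n s * ((1 - q*a) * v n) * (Y * c)"
      using R_Suc[of s] that by (simp only: 1 2)
    \<comment> \<open>Inserting \<open>(1 - a) * v n = 1\<close> into the first term gives
      everything the factor \<open>v n * R n s * Y\<close>; what remains is
      \<open>(1 - a) + (1 - q*c)*a - (1 - c) = c*(1 - q*a)\<close>.\<close>
    also have "\<dots> = R n s * Y * ((1 - a) * v n)
        + v n * ((1 - q*c) * R n s * (Y * a) - (1 - c) * R n s * Y)"
      by (simp add: algebra_simps)
    also have "\<dots> = R n s * q ^ (s*(2*n+1)) + v n * (U (Suc s) - U s)"
      unfolding 3 U_Suc[OF that] by (simp add: U_def Y_def a_def c_def)
    finally show ?thesis .
  qed
  define Z a where "Z = q ^ (n*(2*n+1))" and "a = q ^ (2*n)"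
  have 1: "q ^ (n*(2*Suc n+1)) = Z * a"
    unfolding Z_def a_def by (simp only: power_add[symmetric]) (simp add: algebra_simps)
  have T0: "2*n*(2*n+1) div 2 = n*(2*n+1)"
    by (simp add: mult.assoc)
  have T1: "Suc (2*n)*(Suc (2*n)+1) div 2 = n*(2*n+1) + (2*n+1)"
  proof -
    have "Suc (2*n)*(Suc (2*n)+1) = 2 * (n*(2*n+1) + (2*n+1))" by (simp add: algebra_simps)
    then show ?thesis by simp
  qed
  have v': "v n - q * a * v n = 1"
    using v[of n] by (simp add: a_def algebra_simps)
  have "(\<Sum>s<Suc n. R (Suc n) s * q ^ (s*(2*Suc n+1)))
      = (\<Sum>s<n. R n s * q ^ (s*(2*n+1)) + v n * (U (Suc s) - U s))
        + R (Suc n) n * q ^ (n*(2*Suc n+1))"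
    using step by simp
  also have "R (Suc n) n = (1 - q * (q * a)) * v n"
    by (simp add: R_def a_def)
  also have "(\<Sum>s<n. R n s * q ^ (s*(2*n+1)) + v n * (U (Suc s) - U s))
      = (\<Sum>k<2*n. q ^ (k*(k+1) div 2)) + v n * (U n - U 0)"
    using Suc.IH
    by (simp add: sum.distrib sum_distrib_left[symmetric] sum_lessThan_telescope R_def)
  also have "U n - U 0 = (1 - a) * Z"
    by (simp add: U_def R_def a_def Z_def)
  \<comment> \<open>The telescoped end and the new term \<open>s = n\<close> add up to
    \<open>v n * Z * (1 - (q*a)^2)\<close>, a difference of squares. As \<open>v n\<close> is
    inverse to \<open>1 - q*a\<close>, there remain \<open>Z\<close> and \<open>Z * (q*a)\<close>,
    the terms for \<open>k = 2*n\<close> and \<open>k = 2*n+1\<close>.\<close>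
  also have "(\<Sum>k<2*n. q ^ (k*(k+1) div 2)) + v n * ((1 - a) * Z)
        + (1 - q * (q * a)) * v n * q ^ (n*(2*Suc n+1))
      = (\<Sum>k<2*n. q ^ (k*(k+1) div 2)) + (v n - q*a*v n) * (Z + Z * (q * a))"
    unfolding 1 by (simp add: algebra_simps)
  also have "\<dots> = (\<Sum>k<2*Suc n. q ^ (k*(k+1) div 2))"
  proof -
    have "q ^ (2*n*(2*n+1) div 2) = Z"
      unfolding T0 Z_def ..
    moreover have "q ^ (Suc (2*n)*(Suc (2*n)+1) div 2) = Z * (q * a)"
      unfolding T1 power_add Z_def a_def by simp
    moreover have "2 * Suc n = Suc (Suc (2*n))"
      by simp
    ultimately show ?thesis
      unfolding v' by (simp only: sum.lessThan_Suc mult_1_left add.assoc)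
  qed
  finally show ?case
    unfolding R_def .
qed

section \<open>Generating functions of partitions with parts in a prescribed set\<close>

definition parts_in :: "nat set \<Rightarrow> nat \<Rightarrow> nat multiset set" where
  "parts_in A n = {P. set_mset P \<subseteq> A \<and> sum_mset P = n}"

definition distinct_parts_in :: "nat set \<Rightarrow> nat \<Rightarrow> nat multiset set" where
  "distinct_parts_in A n = {P \<in> parts_in A n. \<forall>i. count P i \<le> 1}"

text \<open>The weight lets one recurrence serve both for counting partitions and for counting their
  parts. Rational coefficients make \<open>inverse\<close> available for series with constant term
  1.\<close>

definition gen_fun :: "(nat \<Rightarrow> 'b set) \<Rightarrow> ('b \<Rightarrow> rat) \<Rightarrow> rat fps" where
  "gen_fun F w = Abs_fps (\<lambda>n. \<Sum>P\<in>F n. w P)"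

lemma gen_fun_nth [simp]: "fps_nth (gen_fun F w) n = (\<Sum>P\<in>F n. w P)"
  by (simp add: gen_fun_def)

lemma gen_fun_add: "gen_fun F (\<lambda>P. w P + w' P) = gen_fun F w + gen_fun F w'"
  by (rule fps_ext) (simp add: sum.distrib)

lemma finite_parts_in: "0 \<notin> A \<Longrightarrow> finite (parts_in A n)"
  by (rule finite_subset[OF _ finite_partitions[of n]]) (auto simp: parts_in_def partitions_def)

lemma finite_distinct_parts_in: "0 \<notin> A \<Longrightarrow> finite (distinct_parts_in A n)"
  by (simp add: distinct_parts_in_def finite_parts_in)

text \<open>Either \<open>i\<close> does not occur, or one copy of it can be removed; the remainder
  may still contain \<open>i\<close>, so the enlarged set reappears on the right.\<close>

lemma parts_in_insert:
  "parts_in (insert i A) n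
   = parts_in A n \<union> (if i \<le> n then add_mset i ` parts_in (insert i A) (n - i) else {})"
proof -
  have "P \<in> add_mset i ` parts_in (insert i A) (n - i) \<and> i \<le> n"
    if "P \<in> parts_in (insert i A) n" "P \<notin> parts_in A n" for P
  proof -
    have "i \<in># P" using that by (auto simp: parts_in_def)
    then obtain Q where "P = add_mset i Q" by (auto dest: multi_member_split)
    then show ?thesis using that by (auto simp: parts_in_def)
  qed
  then show ?thesis
    by (auto simp: parts_in_def split: if_splits)
qed

lemma gen_fun_parts_in_insert:
  assumes "0 \<notin> A" "i \<notin> A" "i > 0"
  shows "gen_fun (parts_in (insert i A)) w = gen_fun (parts_in A) w
    + fps_X ^ i * gen_fun (parts_in (insert i A)) (\<lambda>P. w (add_mset i P))"
proof (rule fps_ext)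
  fix n
  have "(\<Sum>P\<in>parts_in (insert i A) n. w P)
      = (\<Sum>P\<in>parts_in A n. w P)
        + (\<Sum>P\<in>(if i \<le> n then add_mset i ` parts_in (insert i A) (n - i) else {}). w P)"
  proof (subst parts_in_insert, rule sum.union_disjoint)
    have "add_mset i P \<notin> parts_in A n" for P
      using assms(2) by (simp add: parts_in_def)
    then show "parts_in A n \<inter> (if i \<le> n then add_mset i ` parts_in (insert i A) (n - i) else {}) = {}"
      by (simp add: disjoint_iff image_iff) blast
  qed (use assms in \<open>simp_all add: finite_parts_in\<close>)
  also have "(\<Sum>P\<in>(if i \<le> n then add_mset i ` parts_in (insert i A) (n - i) else {}). w P)
      = (if i \<le> n then \<Sum>P\<in>parts_in (insert i A) (n - i). w (add_mset i P) else 0)"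
    by (simp add: sum.reindex inj_on_def)
  finally show "fps_nth (gen_fun (parts_in (insert i A)) w) n = fps_nth (gen_fun (parts_in A) w
    + fps_X ^ i * gen_fun (parts_in (insert i A)) (\<lambda>P. w (add_mset i P))) n"
    by (simp add: fps_X_power_mult_nth not_le)
qed

text \<open>Here removing \<open>i\<close> leaves no further copy, so only \<open>A\<close> occurs
  on the right.\<close>

lemma distinct_parts_in_insert:
  assumes "i \<notin> A"
  shows "distinct_parts_in (insert i A) n
   = distinct_parts_in A n \<union> (if i \<le> n then add_mset i ` distinct_parts_in A (n - i) else {})"
proof -
  have "P \<in> add_mset i ` distinct_parts_in A (n - i) \<and> i \<le> n"
    if P: "P \<in> distinct_parts_in (insert i A) n" "P \<notin> distinct_parts_in A n" for P
  proof -
    have "i \<in># P" using P by (auto simp: parts_in_def distinct_parts_in_def)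
    then obtain Q where Q: "P = add_mset i Q" by (auto dest: multi_member_split)
    have c: "count P j \<le> 1" for j using P by (auto simp: distinct_parts_in_def)
    have "i \<notin># Q" using c[of i] Q by (simp add: not_in_iff)
    moreover have "count Q j \<le> 1" for j using c[of j] Q by (auto split: if_splits)
    ultimately show ?thesis using P Q by (auto simp: parts_in_def distinct_parts_in_def)
  qed
  moreover have "count Q i = 0" if "set_mset Q \<subseteq> A" for Q
    using that assms by (auto simp: not_in_iff[symmetric])
  ultimately show ?thesis
    by (auto simp: parts_in_def distinct_parts_in_def split: if_splits)
qed

lemma gen_fun_distinct_parts_in_insert:
  assumes "0 \<notin> A" "i \<notin> A"
  shows "gen_fun (distinct_parts_in (insert i A)) w = gen_fun (distinct_parts_in A) w
    + fps_X ^ i * gen_fun (distinct_parts_in A) (\<lambda>P. w (add_mset i P))"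
proof (rule fps_ext)
  fix n
  have "(\<Sum>P\<in>distinct_parts_in (insert i A) n. w P)
      = (\<Sum>P\<in>distinct_parts_in A n. w P)
        + (\<Sum>P\<in>(if i \<le> n then add_mset i ` distinct_parts_in A (n - i) else {}). w P)"
  proof (subst distinct_parts_in_insert[OF assms(2)], rule sum.union_disjoint)
    have "add_mset i P \<notin> distinct_parts_in A n" for P
      using assms(2) by (simp add: distinct_parts_in_def parts_in_def)
    then show "distinct_parts_in A n
        \<inter> (if i \<le> n then add_mset i ` distinct_parts_in A (n - i) else {}) = {}"
      by (simp add: disjoint_iff image_iff) blast
  qed (use assms in \<open>simp_all add: finite_distinct_parts_in\<close>)
  also have "(\<Sum>P\<in>(if i \<le> n then add_mset i ` distinct_parts_in A (n - i) else {}). w P)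
      = (if i \<le> n then \<Sum>P\<in>distinct_parts_in A (n - i). w (add_mset i P) else 0)"
    by (simp add: sum.reindex inj_on_def)
  finally show "fps_nth (gen_fun (distinct_parts_in (insert i A)) w) n
      = fps_nth (gen_fun (distinct_parts_in A) w
        + fps_X ^ i * gen_fun (distinct_parts_in A) (\<lambda>P. w (add_mset i P))) n"
    by (simp add: fps_X_power_mult_nth not_le)
qed

lemma fps_inverse_one_minus_X_power:
  "i > 0 \<Longrightarrow> (1 - fps_X ^ i :: rat fps) * inverse (1 - fps_X ^ i) = 1"
  by (rule inverse_mult_eq_1') simp

lemma fps_inverse_one_plus_X_power:
  "i > 0 \<Longrightarrow> (1 + fps_X ^ i :: rat fps) * inverse (1 + fps_X ^ i) = 1"
  by (rule inverse_mult_eq_1') simp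

lemma fps_eq_inverse_one_minus_X_power_mult:
  assumes "i > 0" "(1 - fps_X ^ i) * f = (g :: rat fps)"
  shows "f = inverse (1 - fps_X ^ i) * g"
proof -
  have "f = ((1 - fps_X ^ i) * inverse (1 - fps_X ^ i)) * f"
    by (simp only: fps_inverse_one_minus_X_power[OF assms(1)] mult_1_left)
  also have "\<dots> = inverse (1 - fps_X ^ i) * ((1 - fps_X ^ i) * f)"
    by (simp only: mult_ac)
  finally show ?thesis
    by (simp only: assms(2))
qed

lemma parts_in_empty: "parts_in {} n = (if n = 0 then {{#}} else {})"
  by (auto simp: parts_in_def)

lemma distinct_parts_in_empty: "distinct_parts_in {} n = (if n = 0 then {{#}} else {})"
  by (auto simp: distinct_parts_in_def parts_in_empty)

lemma gen_fun_parts_in_count: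
  assumes "finite A" "0 \<notin> A"
  shows "gen_fun (parts_in A) (\<lambda>_. 1) = (\<Prod>i\<in>A. inverse (1 - fps_X ^ i))"
  using assms
proof (induction A)
  case empty
  show ?case by (rule fps_ext) (simp add: parts_in_empty)
next
  case (insert i A)
  let ?C = "\<lambda>A. gen_fun (parts_in A) (\<lambda>_. 1)"
  have i: "i > 0" using insert.prems by (cases i) auto
  have "?C (insert i A) = ?C A + fps_X ^ i * ?C (insert i A)"
    using gen_fun_parts_in_insert[of A i "\<lambda>_. 1"] insert i by simp
  then have "(1 - fps_X ^ i) * ?C (insert i A) = ?C A"
    by (simp add: algebra_simps)
  then have "?C (insert i A) = inverse (1 - fps_X ^ i) * ?C A"
    by (rule fps_eq_inverse_one_minus_X_power_mult[OF i])
  then show ?case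
    using insert by simp
qed

text \<open>A further part \<open>i\<close> raises the size by 1, so the recurrence for sizes
  contains the counting series as well. Dividing by \<open>1 - fps_X ^ i\<close> then contributes
  one Lambert term for each \<open>i\<close>.\<close>

lemma gen_fun_parts_in_size:
  assumes "finite A" "0 \<notin> A"
  shows "gen_fun (parts_in A) (\<lambda>P. of_nat (size P))
    = gen_fun (parts_in A) (\<lambda>_. 1) * (\<Sum>i\<in>A. fps_X ^ i * inverse (1 - fps_X ^ i))"
  using assms
proof (induction A)
  case empty
  show ?case by (rule fps_ext) (simp add: parts_in_empty)
next
  case (insert i A)
  let ?C = "\<lambda>A. gen_fun (parts_in A) (\<lambda>_. 1)"
  let ?T = "\<lambda>A. gen_fun (parts_in A) (\<lambda>P. of_nat (size P))"
  let ?L = "\<Sum>i\<in>A. fps_X ^ i * inverse (1 - fps_X ^ i :: rat fps)"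
  let ?v = "inverse (1 - fps_X ^ i :: rat fps)"
  have i: "i > 0" using insert.prems by (cases i) auto
  have C: "?C (insert i A) = ?v * ?C A"
    using insert by (simp add: gen_fun_parts_in_count)
  have "?T (insert i A) = ?T A + fps_X ^ i * (?C (insert i A) + ?T (insert i A))"
    using gen_fun_parts_in_insert[of A i "\<lambda>P. of_nat (size P)"] insert i
    by (simp add: gen_fun_add)
  then have "(1 - fps_X ^ i) * ?T (insert i A) = ?T A + fps_X ^ i * ?C (insert i A)"
    by (simp add: algebra_simps)
  then have "?T (insert i A) = ?v * (?T A + fps_X ^ i * ?C (insert i A))"
    by (rule fps_eq_inverse_one_minus_X_power_mult[OF i])
  also have "?T A = ?C A * ?L"
    using insert by simp
  also have "?v * (?C A * ?L + fps_X ^ i * ?C (insert i A)) = ?C (insert i A) * (fps_X ^ i * ?v + ?L)"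
    unfolding C by (simp add: algebra_simps)
  finally show ?case
    using insert by simp
qed

lemma gen_fun_distinct_parts_in_count:
  assumes "finite A" "0 \<notin> A"
  shows "gen_fun (distinct_parts_in A) (\<lambda>_. 1) = (\<Prod>i\<in>A. 1 + fps_X ^ i)"
  using assms
proof (induction A)
  case empty
  show ?case by (rule fps_ext) (simp add: distinct_parts_in_empty)
next
  case (insert i A)
  then show ?case
    using gen_fun_distinct_parts_in_insert[of A i "\<lambda>_. 1"] by (simp add: algebra_simps)
qed

lemma gen_fun_distinct_parts_in_size:
  assumes "finite A" "0 \<notin> A"
  shows "gen_fun (distinct_parts_in A) (\<lambda>P. of_nat (size P))
    = gen_fun (distinct_parts_in A) (\<lambda>_. 1) * (\<Sum>i\<in>A. fps_X ^ i * inverse (1 + fps_X ^ i))"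
  using assms
proof (induction A)
  case empty
  show ?case by (rule fps_ext) (simp add: distinct_parts_in_empty)
next
  case (insert i A)
  let ?C = "\<lambda>A. gen_fun (distinct_parts_in A) (\<lambda>_. 1)"
  let ?T = "\<lambda>A. gen_fun (distinct_parts_in A) (\<lambda>P. of_nat (size P))"
  let ?L = "\<Sum>i\<in>A. fps_X ^ i * inverse (1 + fps_X ^ i :: rat fps)"
  let ?v = "inverse (1 + fps_X ^ i :: rat fps)"
  have i: "i > 0" using insert.prems by (cases i) auto
  have C: "?C (insert i A) = (1 + fps_X ^ i) * ?C A"
    using insert by (simp add: gen_fun_distinct_parts_in_count)
  have "?T (insert i A) = ?T A + fps_X ^ i * (?C A + ?T A)"
    using gen_fun_distinct_parts_in_insert[of A i "\<lambda>P. of_nat (size P)"] insert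
    by (simp add: gen_fun_add)
  also have "?T A = ?C A * ?L"
    using insert by simp
  \<comment> \<open>The factor 1 is kept in order to be replaced by
    \<open>(1 + fps_X ^ i) * ?v\<close>, which produces the common factor
    \<open>?C (insert i A)\<close>.\<close>
  also have "?C A * ?L + fps_X ^ i * (?C A + ?C A * ?L)
      = fps_X ^ i * ?C A * 1 + (1 + fps_X ^ i) * ?C A * ?L"
    by (simp add: algebra_simps)
  also have "\<dots> = fps_X ^ i * ?C A * ((1 + fps_X ^ i) * ?v) + (1 + fps_X ^ i) * ?C A * ?L"
    by (simp only: fps_inverse_one_plus_X_power[OF i])
  also have "\<dots> = ?C (insert i A) * (fps_X ^ i * ?v + ?L)"
    unfolding C by (simp only: algebra_simps)
  finally show ?case
    using insert by simp
qed

section \<open>Partitions of \<open>n\<close> as partitions with bounded parts, and doubling of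
  parts\<close>

text \<open>No part exceeds the sum, so one finite set of parts serves all \<open>n\<close> up to
  \<open>N\<close> and finite products suffice.\<close>

lemma partitions_eq_parts_in:
  assumes "n \<le> N"
  shows "partitions n = parts_in {1..N} n"
proof -
  have "i \<in> {1..N}" if "P \<in> partitions n" "i \<in># P" for P i
  proof -
    have "i \<le> sum_mset P" using that(2) by (auto dest: multi_member_split)
    moreover have "i \<noteq> 0" using that by (auto simp: partitions_def intro: gr0I)
    ultimately show ?thesis using that assms by (auto simp: partitions_def)
  qed
  then show ?thesis
    unfolding parts_in_def by (auto simp: partitions_def)
qed

lemma odd_partitions_eq_parts_in:
  "n \<le> N \<Longrightarrow> odd_partitions n = parts_in {i\<in>{1..N}. odd i} n"
  by (auto simp: odd_partitions_def partitions_eq_parts_in parts_in_def)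

lemma distinct_partitions_eq_distinct_parts_in:
  "n \<le> N \<Longrightarrow> distinct_partitions n = distinct_parts_in {1..N} n"
  by (simp add: distinct_partitions_def partitions_eq_parts_in distinct_parts_in_def)

lemma sum_mset_image_mult: "sum_mset (image_mset ((*) c) P) = c * (sum_mset P :: nat)"
  by (induction P) (auto simp: algebra_simps)

lemma parts_in_doubled: "parts_in ((*) 2 ` A) (2*m) = image_mset ((*) 2) ` parts_in A m"
proof (intro equalityI subsetI)
  fix P assume P: "P \<in> parts_in ((*) 2 ` A) (2*m)"
  define Q where "Q = image_mset (\<lambda>i. i div 2) P"
  have "image_mset ((*) 2) Q = image_mset id P"
    unfolding Q_def multiset.map_comp using P
    by (intro image_mset_cong) (auto simp: parts_in_def)
  then have *: "P = image_mset ((*) 2) Q" by simp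
  have "2 * sum_mset Q = 2 * m"
    using P * sum_mset_image_mult[of 2 Q] by (simp add: parts_in_def)
  moreover have "set_mset Q \<subseteq> A"
    using P by (auto simp: Q_def parts_in_def)
  ultimately show "P \<in> image_mset ((*) 2) ` parts_in A m"
    using * by (auto simp: parts_in_def)
qed (auto simp: parts_in_def sum_mset_image_mult intro!: imageI dest: subsetD)

lemma parts_in_doubled_odd:
  assumes "odd n"
  shows "parts_in ((*) 2 ` A) n = {}"
proof -
  have "even (sum_mset P)" if "set_mset P \<subseteq> (*) 2 ` A" for P
    using that by (induction P) auto
  then show ?thesis
    using assms by (auto simp: parts_in_def)
qed

text \<open>Doubling all parts is injective and preserves the number of parts.\<close>

lemma sum_size_parts_in_doubled:
  "(\<Sum>P\<in>parts_in ((*) 2 ` A) (2*m). f (size P)) = (\<Sum>P\<in>parts_in A m. f (size P))"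
proof -
  have "inj (image_mset ((*) (2::nat)))"
    by (intro multiset.inj_map injI) simp
  then show ?thesis
    unfolding parts_in_doubled by (subst sum.reindex) (auto intro: inj_on_subset)
qed

section \<open>Congruences modulo a power of \<open>fps_X\<close>, and the split into odd and even
  parts\<close>

lemma fps_X_power_dvd_nth:
  fixes f :: "rat fps"
  assumes "fps_X ^ k dvd f" "n < k"
  shows "fps_nth f n = 0"
  using assms by (auto simp: dvd_def fps_X_power_mult_nth)

text \<open>Each factor is 1 modulo \<open>fps_X ^ k\<close>; this discards the surplus factors of a
  truncated product.\<close>

lemma fps_X_power_dvd_prod_minus_one:
  fixes f :: "nat \<Rightarrow> nat"
  assumes "\<And>i. i \<in> I \<Longrightarrow> k \<le> f i"
  shows "(fps_X :: rat fps) ^ k dvd (\<Prod>i\<in>I. 1 - fps_X ^ f i) - 1"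
  using assms
proof (induction I rule: infinite_finite_induct)
  case (insert i I)
  let ?p = "\<Prod>i\<in>I. 1 - fps_X ^ f i :: rat fps"
  have "(\<Prod>i\<in>insert i I. 1 - fps_X ^ f i) - 1 = (?p - 1) - fps_X ^ f i * ?p"
    using insert by (simp add: algebra_simps)
  moreover have "(fps_X :: rat fps) ^ k dvd fps_X ^ f i"
    using insert.prems by (intro le_imp_power_dvd) simp
  ultimately show ?case
    using insert by (metis dvd_diff dvd_mult2 insertI2)
qed auto

lemma one_to_double_eq: "{1..2*M} = {i\<in>{1..2*M}. odd i} \<union> (*) 2 ` {1..M::nat}"
proof -
  have "i \<in> (*) 2 ` {1..M}" if "even i" "i \<in> {1..2*M}" for i
    using that by (intro image_eqI[of _ _ "i div 2"]) auto
  moreover have "(*) 2 ` {1..M} \<subseteq> {1..2*M}"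
    by (rule image_subsetI) simp
  ultimately show ?thesis by blast
qed

lemma odd_up_to_double_eq: "{i\<in>{1..2*M}. odd i} = (\<lambda>r. 2*r+1) ` {..<M::nat}"
proof -
  have "i \<in> (\<lambda>r. 2*r+1) ` {..<M}" if "odd i" "i \<in> {1..2*M}" for i
  proof (rule image_eqI[of _ _ "i div 2"])
    have "i div 2 < M" using that(1) that(2)[unfolded atLeastAtMost_iff] by presburger
    then show "i div 2 \<in> {..<M}" by simp
  qed (use that in simp)
  moreover have "(\<lambda>r. 2*r+1) ` {..<M} \<subseteq> {i\<in>{1..2*M}. odd i}"
    by (rule image_subsetI) simp
  ultimately show ?thesis by blast
qed

text \<open>Since \<open>1 - a*a = (1 - a) * (1 + a)\<close>, the common denominator is
  \<open>1 - a*a\<close>, and the numerators agree by \<open>(1 + a) - 2*a = 1 - a\<close>.\<close>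

lemma lambert_term_plus:
  assumes "i > 0"
  shows "fps_X ^ i * inverse (1 + fps_X ^ i :: rat fps)
    = fps_X ^ i * inverse (1 - fps_X ^ i) - 2 * (fps_X ^ (2*i) * inverse (1 - fps_X ^ (2*i)))"
proof -
  define a u w :: "rat fps"
    where "a = fps_X ^ i" and "u = inverse (1 - a)" and "w = inverse (1 + a)"
  have aa: "fps_X ^ (2*i) = a * a"
    by (simp add: a_def mult_2 power_add)
  have "1 - fps_X ^ (2*i) = (1 - a) * (1 + a)"
    unfolding aa by (simp add: algebra_simps)
  then have 1: "inverse (1 - fps_X ^ (2*i)) = u * w"
    by (simp add: fps_inverse_mult u_def w_def)
  have 2: "(1 - a) * u = 1" "(1 + a) * w = 1"
    unfolding a_def u_def w_def
    by (rule fps_inverse_one_minus_X_power[OF assms] fps_inverse_one_plus_X_power[OF assms])+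
  have "a * u - 2 * (a * a * (u * w)) = a * u * ((1 + a) * w) - 2 * (a * a * (u * w))"
    by (simp only: 2 mult_1_right)
  also have "\<dots> = a * w * ((1 - a) * u)"
    by (simp add: algebra_simps)
  finally have "a * u - 2 * (a * a * (u * w)) = a * w"
    by (simp only: 2 mult_1_right)
  then show ?thesis
    unfolding 1 unfolding aa a_def[symmetric] u_def[symmetric] w_def[symmetric] by (rule sym)
qed

text \<open>Indexing by \<open>r<M\<close> matches the factors in
  \<open>shanks_triangular_sum\<close>.\<close>

lemma gen_fun_even_parts:
  "gen_fun (parts_in ((*) 2 ` {1..M})) (\<lambda>_. 1) = (\<Prod>r<M. inverse (1 - fps_X ^ (2*r+2)))"
proof -
  have "(*) 2 ` {1..M} = (\<lambda>r. 2*r+2) ` {..<M}"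
  proof -
    have "{1..M} = Suc ` {..<M}" by (simp add: image_Suc_lessThan)
    then show ?thesis by (simp add: image_image)
  qed
  then show ?thesis
    by (subst gen_fun_parts_in_count) (auto simp: prod.reindex inj_on_def)
qed

lemma gen_fun_odd_parts:
  "gen_fun (parts_in {i\<in>{1..2*M}. odd i}) (\<lambda>_. 1) = (\<Prod>r<M. inverse (1 - fps_X ^ (2*r+1)))"
  unfolding odd_up_to_double_eq
  by (subst gen_fun_parts_in_count) (auto simp: prod.reindex inj_on_def)

section \<open>Euler's and Gauss' identities modulo \<open>fps_X ^ (2*M)\<close>\<close>

text \<open>Write \<open>1 + fps_X ^ i\<close> as the quotient of \<open>1 - fps_X ^ (2*i)\<close>
  by \<open>1 - fps_X ^ i\<close>. The numerators with \<open>i \<le> M\<close> cancel the even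
  denominators; those with \<open>i > M\<close> form \<open>?H\<close>, which is 1 modulo
  \<open>fps_X ^ (2*M)\<close>.\<close>

lemma euler_distinct_odd:
  "(fps_X :: rat fps) ^ (2*M) dvd
    gen_fun (distinct_parts_in {1..2*M}) (\<lambda>_. 1) - gen_fun (parts_in {i\<in>{1..2*M}. odd i}) (\<lambda>_. 1)"
proof -
  let ?O = "{i\<in>{1..2*M}. odd i}" and ?E = "(*) 2 ` {1..M}"
  let ?u = "\<lambda>i. inverse (1 - fps_X ^ i :: rat fps)"
  let ?H = "\<Prod>i\<in>{M<..2*M}. 1 - fps_X ^ (2*i) :: rat fps"
  have A: "(1 + fps_X ^ i :: rat fps) = (1 - fps_X ^ (2*i)) * ?u i" if "i \<in> {1..2*M}" for i
  proof -
    have "(1 - fps_X ^ (2*i)) * ?u i = (1 + fps_X ^ i) * ((1 - fps_X ^ i) * ?u i)"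
      unfolding mult_2 power_add by (simp only: algebra_simps mult_1_left)
    also have "(1 - fps_X ^ i) * ?u i = 1"
      using that by (intro fps_inverse_one_minus_X_power) simp
    finally show ?thesis
      by simp
  qed
  have "gen_fun (distinct_parts_in {1..2*M}) (\<lambda>_. 1) = (\<Prod>i\<in>{1..2*M}. (1 - fps_X ^ (2*i)) * ?u i)"
    by (subst gen_fun_distinct_parts_in_count) (auto intro!: prod.cong A)
  also have "\<dots> = (\<Prod>i\<in>{1..2*M}. 1 - fps_X ^ (2*i)) * (\<Prod>i\<in>{1..2*M}. ?u i)"
    by (rule prod.distrib)
  also have "(\<Prod>i\<in>{1..2*M}. ?u i) = (\<Prod>i\<in>?O. ?u i) * (\<Prod>i\<in>?E. ?u i)"
    by (subst one_to_double_eq, rule prod.union_disjoint) auto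
  also have "(\<Prod>i\<in>?E. ?u i) = (\<Prod>i\<in>{1..M}. ?u (2*i))"
    by (subst prod.reindex) (auto simp: inj_on_def)
  also have "(\<Prod>i\<in>{1..2*M}. 1 - fps_X ^ (2*i) :: rat fps)
      = (\<Prod>i\<in>{1..M}. 1 - fps_X ^ (2*i)) * ?H"
  proof -
    have "{1..2*M} = {1..M} \<union> {M<..2*M}" by auto
    then show ?thesis by (simp only:) (rule prod.union_disjoint, auto)
  qed
  also have "(\<Prod>i\<in>{1..M}. 1 - fps_X ^ (2*i)) * ?H * ((\<Prod>i\<in>?O. ?u i) * (\<Prod>i\<in>{1..M}. ?u (2*i)))
      = (\<Prod>i\<in>{1..M}. (1 - fps_X ^ (2*i)) * ?u (2*i)) * ((\<Prod>i\<in>?O. ?u i) * ?H)"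
    unfolding prod.distrib by (simp only: mult_ac)
  also have "(\<Prod>i\<in>{1..M}. (1 - fps_X ^ (2*i)) * ?u (2*i)) = 1"
    by (rule prod.neutral) (auto intro!: fps_inverse_one_minus_X_power)
  also have "(\<Prod>i\<in>?O. ?u i) = gen_fun (parts_in ?O) (\<lambda>_. 1)"
    by (rule gen_fun_parts_in_count[symmetric]) auto
  finally have "gen_fun (distinct_parts_in {1..2*M}) (\<lambda>_. 1) - gen_fun (parts_in ?O) (\<lambda>_. 1)
      = gen_fun (parts_in ?O) (\<lambda>_. 1) * (?H - 1)"
    by (simp add: algebra_simps)
  moreover have "(fps_X :: rat fps) ^ (2*M) dvd ?H - 1"
    by (rule fps_X_power_dvd_prod_minus_one) auto
  ultimately show ?thesis
    by simp
qed

text \<open>Multiply the finite identity by the even-part product: the term \<open>s = 0\<close>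
  becomes the odd-part product, and each term with \<open>s \<ge> 1\<close> has the factor
  \<open>fps_X ^ (s*(2*M+1))\<close>.\<close>

lemma gauss_triangular:
  "(fps_X :: rat fps) ^ (2*M) dvd
    gen_fun (parts_in ((*) 2 ` {1..M})) (\<lambda>_. 1) * (\<Sum>k<2*M. fps_X ^ (k*(k+1) div 2))
    - gen_fun (parts_in {i\<in>{1..2*M}. odd i}) (\<lambda>_. 1)"
\<comment> \<open>For \<open>M = 0\<close> there is no term \<open>s = 0\<close> to split off, but
  the modulus is then 1.\<close>
proof (cases "M = 0")
  case False
  let ?v = "\<lambda>r. inverse (1 - fps_X ^ (2*r+1) :: rat fps)"
  let ?w = "\<lambda>r. inverse (1 - fps_X ^ (2*r+2) :: rat fps)"
  define R :: "nat \<Rightarrow> rat fps" where "R s = (\<Prod>r\<in>{s..<M}. (1 - fps_X ^ (2*r+2)) * ?v r)" for s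
  let ?rest = "\<Sum>s\<in>{1..<M}. R s * fps_X ^ (s*(2*M+1))"
  have "(\<Sum>k<2*M. fps_X ^ (k*(k+1) div 2)) = (\<Sum>s<M. R s * fps_X ^ (s*(2*M+1)))"
    unfolding R_def
    by (rule shanks_triangular_sum[symmetric]) (rule fps_inverse_one_minus_X_power, simp)
  also have "\<dots> = R 0 + ?rest"
    using False by (simp add: lessThan_atLeast0 sum.atLeast_Suc_lessThan)
  finally have psi: "(\<Sum>k<2*M. fps_X ^ (k*(k+1) div 2)) = R 0 + ?rest" .
  have "(\<Prod>r<M. ?w r) * R 0 = (\<Prod>r<M. ((1 - fps_X ^ (2*r+2)) * ?w r) * ?v r)"
    unfolding R_def lessThan_atLeast0 prod.distrib by (simp only: mult_ac)
  also have "\<dots> = (\<Prod>r<M. ?v r)"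
    by (intro prod.cong refl) (subst fps_inverse_one_minus_X_power, simp_all)
  finally have R0: "(\<Prod>r<M. ?w r) * R 0 = (\<Prod>r<M. ?v r)" .
  have "(fps_X :: rat fps) ^ (2*M) dvd ?rest"
  proof (rule dvd_sum)
    fix s assume "s \<in> {1..<M}"
    then have "2*M \<le> s*(2*M+1)"
      by (cases s) auto
    then show "(fps_X :: rat fps) ^ (2*M) dvd R s * fps_X ^ (s*(2*M+1))"
      by (intro dvd_mult le_imp_power_dvd)
  qed
  then show ?thesis
    unfolding gen_fun_even_parts gen_fun_odd_parts psi
    by (simp only: distrib_left[of _ "R 0"] R0 add_diff_cancel_left' dvd_mult)
qed simp

section \<open>The excess of parts, and its coefficients in terms of \<open>S\<close>\<close>

lemma parts_excess_gen_fun: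
  "(fps_X :: rat fps) ^ (2*M) dvd
    gen_fun (parts_in {i\<in>{1..2*M}. odd i}) (\<lambda>P. of_nat (size P))
    - gen_fun (distinct_parts_in {1..2*M}) (\<lambda>P. of_nat (size P))
    - gen_fun (parts_in ((*) 2 ` {1..M})) (\<lambda>P. of_nat (size P))
      * (\<Sum>k<2*M. fps_X ^ (k*(k+1) div 2))"
    (is "_ dvd ?TO - ?TD - ?TE * ?psi")
proof -
  let ?O = "{i\<in>{1..2*M}. odd i}" and ?E = "(*) 2 ` {1..M}"
  define lam :: "nat \<Rightarrow> rat fps" where "lam i = fps_X ^ i * inverse (1 - fps_X ^ i)" for i
  define CO CD CE where "CO = gen_fun (parts_in ?O) (\<lambda>_. 1)"
    and "CD = gen_fun (distinct_parts_in {1..2*M}) (\<lambda>_. 1)"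
    and "CE = gen_fun (parts_in ?E) (\<lambda>_. 1)"
  define LO LE H where "LO = (\<Sum>i\<in>?O. lam i)" and "LE = (\<Sum>i\<in>?E. lam i)"
    and "H = (\<Sum>i\<in>{M<..2*M}. lam (2*i))"
  have TO: "?TO = CO * LO"
    unfolding CO_def LO_def lam_def by (rule gen_fun_parts_in_size) auto
  have TE: "?TE = CE * LE"
    unfolding CE_def LE_def lam_def by (rule gen_fun_parts_in_size) auto
  have "(\<Sum>i\<in>{1..2*M}. fps_X ^ i * inverse (1 + fps_X ^ i :: rat fps))
      = (\<Sum>i\<in>{1..2*M}. lam i - 2 * lam (2*i))"
    unfolding lam_def by (intro sum.cong refl lambert_term_plus) simp
  also have "\<dots> = (\<Sum>i\<in>{1..2*M}. lam i) - 2 * (\<Sum>i\<in>{1..2*M}. lam (2*i))"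
    by (simp add: sum_subtractf sum_distrib_left)
  also have "(\<Sum>i\<in>{1..2*M}. lam i) = LO + LE"
    unfolding LO_def LE_def by (subst one_to_double_eq, rule sum.union_disjoint) auto
  \<comment> \<open>The doubled indices with \<open>i \<le> M\<close> run through \<open>?E\<close>;
    the others only give terms of order above \<open>2*M\<close>, collected in
    \<open>H\<close>.\<close>
  also have "(\<Sum>i\<in>{1..2*M}. lam (2*i)) = (\<Sum>i\<in>{1..M}. lam (2*i)) + H"
  proof -
    have "{1..2*M} = {1..M} \<union> {M<..2*M}" by auto
    then show ?thesis unfolding H_def by (simp only:) (rule sum.union_disjoint, auto)
  qed
  also have "(\<Sum>i\<in>{1..M}. lam (2*i)) = LE"
    unfolding LE_def by (subst sum.reindex) (auto simp: inj_on_def)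
  finally have TD: "?TD = CD * (LO + LE - 2 * (LE + H))"
    unfolding CD_def by (subst gen_fun_distinct_parts_in_size) auto
  have "fps_X ^ (2*M) dvd H"
    unfolding H_def lam_def by (intro dvd_sum dvd_mult2 le_imp_power_dvd) auto
  moreover have "fps_X ^ (2*M) dvd CD - CO"
    unfolding CD_def CO_def by (rule euler_distinct_odd)
  moreover have "fps_X ^ (2*M) dvd CE * ?psi - CO"
    unfolding CE_def CO_def by (rule gauss_triangular)
  \<comment> \<open>Each of the three terms contains one factor already known to be divisible:
    \<open>H\<close>, Euler's difference or Gauss' difference.\<close>
  moreover have "?TO - ?TD - ?TE * ?psi
      = 2 * CD * H - (CD - CO) * (LO - LE) - LE * (CE * ?psi - CO)"
    unfolding TO TE TD by (simp add: algebra_simps)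
  ultimately show ?thesis
    by (simp only: dvd_diff dvd_mult dvd_mult2)
qed

text \<open>If \<open>n - t\<close> is odd, the argument of \<open>S\<close> is not an integer and
  no partition into even parts exists. If it is \<open>2*m\<close>, halving the parts gives all
  partitions of \<open>m\<close>, as \<open>m < M\<close>.\<close>

lemma sum_size_even_parts_eq_S:
  assumes "n < 2*M" "t \<le> n"
  shows "of_int (S (of_nat n / 2 - of_nat t / 2))
    = (\<Sum>P\<in>parts_in ((*) 2 ` {1..M}) (n - t). of_nat (size P) :: rat)"
proof (cases "even (n - t)")
  case True
  then obtain m where m: "n - t = 2*m" by (elim evenE)
  then have n: "n = 2*m + t" using assms by simp
  have x: "(of_nat n / 2 - of_nat t / 2 :: rat) = of_nat m"
    by (simp add: n field_simps)
  have "(\<Sum>P\<in>parts_in ((*) 2 ` {1..M}) (n - t). of_nat (size P) :: rat)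
      = (\<Sum>P\<in>partitions m. of_nat (size P))"
    using assms n unfolding m sum_size_parts_in_doubled
    by (subst partitions_eq_parts_in[of m M]) auto
  \<comment> \<open>For \<open>m = 0\<close> the convention \<open>S 0 = 0\<close> agrees with the
    empty partition having no parts.\<close>
  moreover have "(\<Sum>P\<in>partitions 0. of_nat (size P) :: rat) = 0"
  proof (rule sum.neutral, rule ballI)
    fix P assume "P \<in> partitions 0"
    then have "P = {#}"
      by (cases P) (auto simp: partitions_def)
    then show "(of_nat (size P) :: rat) = 0"
      by simp
  qed
  ultimately show ?thesis
    unfolding x by (auto simp: S_def)
next
  case False
  have "(of_nat n / 2 - of_nat t / 2 :: rat) \<notin> \<int>"
  proof
    assume "(of_nat n / 2 - of_nat t / 2 :: rat) \<in> \<int>"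
    then obtain z where "(of_nat n / 2 - of_nat t / 2 :: rat) = of_int z" by (elim Ints_cases)
    then have "of_int (int n - int t) = (of_int (2 * z) :: rat)" by (simp add: field_simps)
    then have "int n - int t = 2 * z" by (simp only: of_int_eq_iff)
    then have "int (n - t) = 2 * z" using assms by simp
    then show False using False by presburger
  qed
  then show ?thesis
    using False by (simp add: S_def parts_in_doubled_odd)
qed

theorem corollary3p2:
  fixes n :: nat
  shows "(\<lambda>k::nat. S (of_nat n / 2 - of_nat (k * (k + 1)) / 4)) sums b n"
proof -
  \<comment> \<open>With this choice the degree \<open>n\<close> lies below the modulus
    \<open>2*M\<close>, and \<open>k<2*M\<close> covers every \<open>k\<close> with
    \<open>t k \<le> n\<close>.\<close>
  define M where "M = Suc n"
  define t where "t k = k * (k + 1) div 2" for k :: nat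
  let ?O = "{i\<in>{1..2*M}. odd i}" and ?E = "(*) 2 ` {1..M}"
  let ?f = "\<lambda>k::nat. S (of_nat n / 2 - of_nat (k * (k + 1)) / 4)"
  have arg: "?f k = S (of_nat n / 2 - of_nat (t k) / 2)" for k
  proof -
    have "k * (k + 1) = 2 * t k"
      by (simp add: t_def)
    then show ?thesis
      by (simp only:) simp
  qed
  \<comment> \<open>The argument of \<open>S\<close> is negative here, matching the vanishing
    coefficient of a series shifted beyond degree \<open>n\<close>.\<close>
  have zero: "?f k = 0" if "n < t k" for k
    unfolding arg using that by (simp add: S_def)
  have t_ge: "k \<le> t k" for k
    by (induction k) (auto simp: t_def)
  have n: "n < 2*M" by (simp add: M_def)
  have "of_int (b n) = (\<Sum>P\<in>parts_in ?O n. of_nat (size P) :: rat)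
      - (\<Sum>P\<in>distinct_parts_in {1..2*M} n. of_nat (size P))"
    using n odd_partitions_eq_parts_in[of n "2*M"] distinct_partitions_eq_distinct_parts_in[of n "2*M"]
    by (simp add: b_def)
  also have "\<dots> = fps_nth (gen_fun (parts_in ?E) (\<lambda>P. of_nat (size P)) * (\<Sum>k<2*M. fps_X ^ t k)) n"
    using fps_X_power_dvd_nth[OF parts_excess_gen_fun n] by (simp add: t_def)
  also have "\<dots> = (\<Sum>k<2*M. if n < t k then 0
      else \<Sum>P\<in>parts_in ?E (n - t k). of_nat (size P))"
    by (simp add: sum_distrib_left fps_sum_nth fps_X_power_mult_right_nth cong: if_cong)
  also have "\<dots> = (\<Sum>k<2*M. of_int (?f k))"
  proof (intro sum.cong refl)
    fix k
    show "(if n < t k then 0 else \<Sum>P\<in>parts_in ?E (n - t k). of_nat (size P) :: rat) = of_int (?f k)"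
      using zero[of k] sum_size_even_parts_eq_S[OF n, of "t k"] by (simp only: arg) simp
  qed
  finally have "b n = (\<Sum>k<2*M. ?f k)"
    by (simp only: of_int_sum[symmetric] of_int_eq_iff)
  moreover have "?f sums (\<Sum>k<2*M. ?f k)"
  proof (rule sums_finite)
    fix k assume "k \<notin> {..<2*M}"
    then have "n < t k" using t_ge[of k] by (simp add: M_def)
    then show "?f k = 0" by (rule zero)
  qed simp
  ultimately show ?thesis
    by simp
qed

end
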